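(* Let $J\ge 3$, let $\tau$ be a non-identical transposition of the reference category $J$ (that is, $\tau$ is the transposition of $\{1,\dots,J\}$ exchanging $J$ and some $\tau(J)\in\{1,\dots,J-1\}$), and let $B_\tau$ be the matrix obtained from the identity matrix of dimension $J-1$ by replacing its $\tau(J)$-th column by a column all of whose entries are $-1$. Then, for every design matrix $Z\in\mathfrak{Z}$, the following two models are equal: $$(\text{reference},\text{logistic},Z)_\tau=(\text{reference},\text{logistic},B_\tau Z).$$
   Context: Setting. Let $J\ge 3$ (number of categories), $p\ge 1$, and let $\mathcal{X}\subseteq\mathbb{R}^p$ be the nonempty set of values of the explanatory vector $x$. Let $\mathcal{M}=\{\pi\in\,]0,1[^{J-1} : \sum_{j=1}^{J-1}\pi_j<1\}$; for $\pi\in\mathcal{M}$ put $\pi_J=1-\sum_{j=1}^{J-1}\pi_j$ ($\pi_j$ is the probability of category $j$). Ratio. The reference ratio $r:\mathcal{M}\to\,]0,1[^{J-1}$ is $r_j(\pi)=\pi_j/(\pi_j+\pi_J)$, $j=1,\dots,J-1$; it is a bijection onto $]0,1[^{J-1}$. Cdf. The logistic cdf is $F(w)=e^w/(1+e^w)$, $w\in\mathbb{R}$. Design matrices. The complete design matrix $Z_c(x)$ is the $(J-1)\times(J-1)(1+p)$ matrix with $Z_c(x)\beta=(\alpha_j+x^t\delta_j)_{j=1,\dots,J-1}$ for $\beta=(\alpha_1,\dots,\alpha_{J-1},\delta_1^t,\dots,\delta_{J-1}^t)^t$, $\alpha_j\in\mathbb{R}$, $\delta_j\in\mathbb{R}^p$.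 The set $\mathfrak{Z}$ of design matrices consists of all matrix functions $Z:x\mapsto Z_c(x)C$, where $C$ is a constant real matrix of full column rank with $q$ columns, $J-1+p\le q\le (J-1)(1+p)$. For a constant matrix $M$ of dimension $J-1$, $MZ$ denotes $x\mapsto MZ(x)$. Models. The model $(\text{reference},\text{logistic},Z)$, with $Z$ having $q$ columns, has parameter space $\mathbb{R}^q$. For $\beta\in\mathbb{R}^q$ and $x\in\mathcal{X}$, it defines the unique $\pi=\pi(x;\beta)\in\mathcal{M}$ with $r(\pi)=(F(\eta_1),\dots,F(\eta_{J-1}))^t$, where $\eta=Z(x)\beta$. Permuted models. For a permutation $\sigma$ of $\{1,\dots,J\}$ and $\pi\in\mathcal{M}$, let $\pi_\sigma=(\pi_{\sigma(1)},\dots,\pi_{\sigma(J-1)})\in\mathcal{M}$. The permuted model $(r,F,Z)_\sigma$ has the same parameter space as $(r,F,Z)$ and defines $\pi=\pi(x;\beta)\in\mathcal{M}$ by $r(\pi_\sigma)=(F(\eta_1),\dots,F(\eta_{J-1}))^t$, $\eta=Z(x)\beta$. Two (possibly permuted) models are equal if they have the same parameter space and give the same $\pi(x;\beta)$ for all $x\in\mathcal{X}$ and all $\beta$ in it. *)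

theory Defs
  imports Complex_Main "HOL-Combinatorics.Permutations" "Jordan_Normal_Form.DL_Rank"
begin

(* Categories are numbered 1, ..., J as in the mathematical text, whereas vectors and matrices
   are indexed from 0: the entry for category j sits at index j - 1. *)

definition simplex :: "nat \<Rightarrow> real vec set" where
  "simplex J = {\<pi> \<in> carrier_vec (J - 1).
     (\<forall>i<J - 1. 0 < \<pi> $ i \<and> \<pi> $ i < 1) \<and> (\<Sum>i<J - 1. \<pi> $ i) < 1}"

definition prob_of :: "nat \<Rightarrow> real vec \<Rightarrow> nat \<Rightarrow> real" where
  "prob_of J \<pi> j = (if j = J then 1 - (\<Sum>i<J - 1. \<pi> $ i) else \<pi> $ (j - 1))"

definition reference :: "nat \<Rightarrow> real vec \<Rightarrow> real vec" where
  "reference J \<pi> =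
     vec (J - 1) (\<lambda>i. prob_of J \<pi> (i + 1) / (prob_of J \<pi> (i + 1) + prob_of J \<pi> J))"

definition logistic :: "real \<Rightarrow> real" where
  "logistic w = exp w / (1 + exp w)"

(* Column j - 1 carries alpha_j, and columns (J - 1) + (j - 1) p, ..., (J - 1) + j p - 1 carry
   delta_j; see complete_design_mult_vec below. *)
definition complete_design :: "nat \<Rightarrow> nat \<Rightarrow> real vec \<Rightarrow> real mat" where
  "complete_design J p x = mat (J - 1) ((J - 1) * (1 + p)) (\<lambda>(i, c).
     if c < J - 1 then (if c = i then 1 else 0)
     else if (c - (J - 1)) div p = i then x $ ((c - (J - 1)) mod p) else 0)"

(* The elements of the set of design matrices that have q columns.  X is the set of values of
   the explanatory vector; a design matrix is a function on X, its values elsewhere are junk. *)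
definition design_matrices :: "nat \<Rightarrow> nat \<Rightarrow> real vec set \<Rightarrow> nat \<Rightarrow> (real vec \<Rightarrow> real mat) set" where
  "design_matrices J p X q = {Z. J - 1 + p \<le> q \<and> q \<le> (J - 1) * (1 + p) \<and>
     (\<exists>C \<in> carrier_mat ((J - 1) * (1 + p)) q.
        vec_space.rank ((J - 1) * (1 + p)) C = q \<and>
        (\<forall>x\<in>X. Z x = complete_design J p x * C))}"

datatype model =
  Model (parameter_space: "real vec set") (probabilities: "real vec \<Rightarrow> real vec \<Rightarrow> real vec")

definition models_equal :: "real vec set \<Rightarrow> model \<Rightarrow> model \<Rightarrow> bool" where
  "models_equal X m m' \<longleftrightarrow> parameter_space m = parameter_space m' \<and>
     (\<forall>x\<in>X. \<forall>\<beta>\<in>parameter_space m. probabilities m x \<beta> = probabilities m' x \<beta>)"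

(* The argument q is the number of columns of Z. *)
definition glm :: "nat \<Rightarrow> (real vec \<Rightarrow> real vec) \<Rightarrow> (real \<Rightarrow> real) \<Rightarrow> nat \<Rightarrow>
    (real vec \<Rightarrow> real mat) \<Rightarrow> model" where
  "glm J r F q Z = Model (carrier_vec q)
     (\<lambda>x \<beta>. THE \<pi>. \<pi> \<in> simplex J \<and> r \<pi> = map_vec F (Z x *\<^sub>v \<beta>))"

definition permute_probs :: "nat \<Rightarrow> (nat \<Rightarrow> nat) \<Rightarrow> real vec \<Rightarrow> real vec" where
  "permute_probs J \<sigma> \<pi> = vec (J - 1) (\<lambda>i. prob_of J \<pi> (\<sigma> (i + 1)))"

definition permuted_glm :: "nat \<Rightarrow> (nat \<Rightarrow> nat) \<Rightarrow> (real vec \<Rightarrow> real vec) \<Rightarrow> (real \<Rightarrow> real) \<Rightarrow> nat \<Rightarrow>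
    (real vec \<Rightarrow> real mat) \<Rightarrow> model" where
  "permuted_glm J \<sigma> r F q Z = Model (carrier_vec q)
     (\<lambda>x \<beta>. THE \<pi>. \<pi> \<in> simplex J \<and> r (permute_probs J \<sigma> \<pi>) = map_vec F (Z x *\<^sub>v \<beta>))"

definition B_matrix :: "nat \<Rightarrow> (nat \<Rightarrow> nat) \<Rightarrow> real mat" where
  "B_matrix J \<tau> = mat (J - 1) (J - 1) (\<lambda>(i, c). if c + 1 = \<tau> J then -1 else 1\<^sub>m (J - 1) $$ (i, c))"

lemma complete_design_mult_vec:
  fixes \<beta> x :: "real vec"
  assumes "\<beta> \<in> carrier_vec ((J - 1) * (1 + p))" and "x \<in> carrier_vec p" and "1 \<le> p"
  shows "complete_design J p x *\<^sub>v \<beta> =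
    vec (J - 1) (\<lambda>i. \<beta> $ i + x \<bullet> vec p (\<lambda>l. \<beta> $ ((J - 1) + i * p + l)))"
proof (rule eq_vecI)
  fix i assume "i < dim_vec (vec (J - 1) (\<lambda>i. \<beta> $ i + x \<bullet> vec p (\<lambda>l. \<beta> $ ((J - 1) + i * p + l))))"
  then have i: "i < J - 1" by simp
  have sum_split: "(\<Sum>c<a + b. g c) = (\<Sum>c<a. g c) + (\<Sum>c<b. g (a + c))" for a b and g :: "nat \<Rightarrow> real"
    by (induction b) (simp_all add: add.assoc)
  define K where "K = J - 1"
  have iK: "i < K" using i K_def by simp
  define f where "f c = complete_design J p x $$ (i, c) * \<beta> $ c" for c
  have "(complete_design J p x *\<^sub>v \<beta>) $ i = (\<Sum>c<K * (1 + p). f c)"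
    using assms i by (auto simp: scalar_prod_def complete_design_def f_def K_def
        lessThan_atLeast0 row_def intro!: sum.cong)
  also have "\<dots> = (\<Sum>c<K + K * p. f c)" by (simp add: algebra_simps)
  also have "\<dots> = (\<Sum>c<K. f c) + (\<Sum>c<K * p. f (K + c))"
    by (rule sum_split)
  also have "(\<Sum>c<K. f c) = (\<Sum>c<K. if c = i then \<beta> $ c else 0)"
  proof (rule sum.cong)
    fix c assume "c \<in> {..<K}"
    then have c: "c < J - 1" by (simp add: K_def)
    then have "c < (J - 1) * (1 + p)" by (simp add: trans_less_add1)
    then show "f c = (if c = i then \<beta> $ c else 0)"
      using i c unfolding f_def complete_design_def by simp
  qed simp
  also have "\<dots> = \<beta> $ i" using iK by simp
  also have "(\<Sum>c<K * p. f (K + c)) = (\<Sum>c<K * p. if c div p = i then x $ (c mod p) * \<beta> $ (K + c) else 0)"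
    using i by (intro sum.cong) (auto simp: f_def complete_design_def K_def)
  also have "\<dots> = (\<Sum>c\<in>(\<lambda>l. i * p + l) ` {..<p}. x $ (c mod p) * \<beta> $ (K + c))"
  proof (rule sum.mono_neutral_cong_right)
    have "i * p + l < K * p" if "l < p" for l
    proof -
      have "i * p + l < Suc i * p" using that by simp
      also have "\<dots> \<le> K * p" using iK by (intro mult_right_mono) auto
      finally show ?thesis .
    qed
    then show "(\<lambda>l. i * p + l) ` {..<p} \<subseteq> {..<K * p}" by auto
    show "\<forall>c\<in>{..<K * p} - (\<lambda>l. i * p + l) ` {..<p}.
        (if c div p = i then x $ (c mod p) * \<beta> $ (K + c) else 0) = 0"
    proof
      fix c assume c: "c \<in> {..<K * p} - (\<lambda>l. i * p + l) ` {..<p}"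
      have "c div p \<noteq> i"
      proof
        assume "c div p = i"
        then have "c = i * p + c mod p" by (metis div_mult_mod_eq)
        moreover have "c mod p < p" using assms(3) by simp
        ultimately show False using c by blast
      qed
      then show "(if c div p = i then x $ (c mod p) * \<beta> $ (K + c) else 0) = 0" by simp
    qed
  qed (use assms(3) in auto)
  also have "\<dots> = (\<Sum>l<p. x $ l * \<beta> $ (K + i * p + l))"
    by (subst sum.reindex) (auto simp: inj_on_def add.assoc intro!: sum.cong)
  finally show "(complete_design J p x *\<^sub>v \<beta>) $ i =
      vec (J - 1) (\<lambda>i. \<beta> $ i + x \<bullet> vec p (\<lambda>l. \<beta> $ ((J - 1) + i * p + l))) $ i"
    using i by (simp add: scalar_prod_def K_def lessThan_atLeast0)
qed (simp add: complete_design_def)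

lemma reference_bij_betw:
  "bij_betw (reference J) (simplex J) {u \<in> carrier_vec (J - 1). \<forall>i<J - 1. 0 < u $ i \<and> u $ i < 1}"
proof (rule bij_betw_byWitness)
  define w where "w u i = u $ i / (1 - u $ i)" for u :: "real vec" and i
  define inv_r where "inv_r u = vec (J - 1) (\<lambda>i. w u i / (1 + (\<Sum>k<J - 1. w u k)))" for u
  have ref: "reference J \<pi> $ i = \<pi> $ i / (\<pi> $ i + (1 - (\<Sum>k<J - 1. \<pi> $ k)))" if "i < J - 1" for \<pi> i
    using that by (simp add: reference_def prob_of_def)
  show "\<forall>\<pi>\<in>simplex J. inv_r (reference J \<pi>) = \<pi>"
  proof
    fix \<pi> assume \<pi>: "\<pi> \<in> simplex J"
    define s where "s = 1 - (\<Sum>k<J - 1. \<pi> $ k)"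
    have s: "s > 0" using \<pi> by (simp add: simplex_def s_def)
    have pos: "\<pi> $ i > 0" if "i < J - 1" for i using \<pi> that by (simp add: simplex_def)
    have w: "w (reference J \<pi>) i = \<pi> $ i / s" if "i < J - 1" for i
    proof -
      have "1 - \<pi> $ i / (\<pi> $ i + s) = s / (\<pi> $ i + s)"
        using pos[OF that] s by (simp add: diff_divide_eq_iff)
      then show ?thesis
        using pos[OF that] s unfolding w_def ref[OF that] s_def[symmetric] by simp
    qed
    have "(\<Sum>k<J - 1. w (reference J \<pi>) k) = (1 - s) / s"
      using w by (simp add: s_def sum_divide_distrib)
    then have "1 + (\<Sum>k<J - 1. w (reference J \<pi>) k) = 1 / s" using s by (simp add: field_simps)
    then show "inv_r (reference J \<pi>) = \<pi>"
      using s w \<pi> by (intro eq_vecI) (auto simp: inv_r_def simplex_def)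
  qed
  have facts: "w u i > 0" "1 + (\<Sum>k<J - 1. w u k) > w u i" "1 + (\<Sum>k<J - 1. w u k) > 0"
    if u: "\<forall>i<J - 1. 0 < u $ i \<and> u $ i < 1" and i: "i < J - 1" for u :: "real vec" and i
  proof -
    have pos: "w u k > 0" if "k < J - 1" for k using u that by (simp add: w_def)
    show "w u i > 0" using pos i .
    have "w u i \<le> (\<Sum>k<J - 1. w u k)"
      by (rule member_le_sum) (use pos i in \<open>auto intro: less_imp_le\<close>)
    then show "1 + (\<Sum>k<J - 1. w u k) > w u i" "1 + (\<Sum>k<J - 1. w u k) > 0"
      using pos[OF i] by auto
  qed
  have inv_sum: "1 - (\<Sum>i<J - 1. inv_r u $ i) = 1 / (1 + (\<Sum>k<J - 1. w u k))"
    and S_pos: "1 + (\<Sum>k<J - 1. w u k) > 0"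
    if u: "\<forall>i<J - 1. 0 < u $ i \<and> u $ i < 1" for u :: "real vec"
  proof -
    show pos: "1 + (\<Sum>k<J - 1. w u k) > 0"
      by (intro add_pos_nonneg sum_nonneg) (use facts(1)[OF u] in \<open>auto intro: less_imp_le\<close>)
    have "(\<Sum>i<J - 1. inv_r u $ i) = (\<Sum>k<J - 1. w u k) / (1 + (\<Sum>k<J - 1. w u k))"
      by (simp add: inv_r_def sum_divide_distrib)
    then show "1 - (\<Sum>i<J - 1. inv_r u $ i) = 1 / (1 + (\<Sum>k<J - 1. w u k))"
      using pos by (simp add: field_simps)
  qed
  show "\<forall>u\<in>{u \<in> carrier_vec (J - 1). \<forall>i<J - 1. 0 < u $ i \<and> u $ i < 1}. reference J (inv_r u) = u"
  proof
    fix u :: "real vec" assume u: "u \<in> {u \<in> carrier_vec (J - 1). \<forall>i<J - 1. 0 < u $ i \<and> u $ i < 1}"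
    then have u': "\<forall>i<J - 1. 0 < u $ i \<and> u $ i < 1" by simp
    show "reference J (inv_r u) = u"
    proof (rule eq_vecI)
      fix i assume "i < dim_vec u"
      then have i: "i < J - 1" using u by auto
      define S where "S = 1 + (\<Sum>k<J - 1. w u k)"
      have ne: "1 - u $ i \<noteq> 0" using u' i by auto
      have S: "S > 0" using S_pos[OF u'] by (simp add: S_def)
      have "reference J (inv_r u) $ i = (w u i / S) / (w u i / S + 1 / S)"
        unfolding ref[OF i] inv_sum[OF u'] using i by (simp add: inv_r_def S_def)
      also have "\<dots> = w u i / (w u i + 1)"
        using S by (simp add: add_divide_distrib[symmetric])
      also have "w u i + 1 = 1 / (1 - u $ i)" using ne by (simp add: w_def add_divide_eq_iff diff_divide_distrib[symmetric] field_simps)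
      also have "w u i / (1 / (1 - u $ i)) = u $ i" using ne by (simp add: w_def)
      finally show "reference J (inv_r u) $ i = u $ i" .
    qed (use u in \<open>auto simp: reference_def\<close>)
  qed
  show "reference J ` simplex J \<subseteq> {u \<in> carrier_vec (J - 1). \<forall>i<J - 1. 0 < u $ i \<and> u $ i < 1}"
    using ref by (auto simp: reference_def prob_of_def simplex_def add_pos_pos)
  show "inv_r ` {u \<in> carrier_vec (J - 1). \<forall>i<J - 1. 0 < u $ i \<and> u $ i < 1} \<subseteq> simplex J"
  proof
    fix \<pi> assume "\<pi> \<in> inv_r ` {u \<in> carrier_vec (J - 1). \<forall>i<J - 1. 0 < u $ i \<and> u $ i < 1}"
    then obtain u where u: "\<forall>i<J - 1. 0 < u $ i \<and> u $ i < 1" and \<pi>: "\<pi> = inv_r u" by auto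
    have "(\<Sum>i<J - 1. inv_r u $ i) < 1"
      using inv_sum[OF u] S_pos[OF u] by (smt (verit) zero_less_divide_1_iff)
    then show "\<pi> \<in> simplex J"
      using facts[OF u] unfolding \<pi> by (auto simp: simplex_def inv_r_def)
  qed
qed

lemma permute_probs_bij_betw:
  assumes "2 \<le> J" and \<sigma>: "\<sigma> permutes {1..J}"
  shows "bij_betw (permute_probs J \<sigma>) (simplex J) (simplex J)"
proof -
  have split: "(\<Sum>j=1..J. g j) = (\<Sum>i<J - 1. g (i + 1)) + g J" for g :: "nat \<Rightarrow> real"
  proof -
    obtain n where n: "J = Suc n" using assms(1) by (cases J) auto
    have "(\<Sum>j=1..n. g j) = (\<Sum>i<n. g (Suc i))"
      by (rule sum.reindex_bij_witness[of _ Suc "\<lambda>j. j - 1"]) auto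
    then show ?thesis by (simp add: n)
  qed
  have probs: "(\<Sum>j=1..J. prob_of J \<pi> j) = 1" "\<forall>j\<in>{1..J}. 0 < prob_of J \<pi> j" if "\<pi> \<in> simplex J" for \<pi>
  proof -
    have "(\<Sum>i<J - 1. prob_of J \<pi> (i + 1)) = (\<Sum>i<J - 1. \<pi> $ i)"
      by (rule sum.cong) (auto simp: prob_of_def)
    then show "(\<Sum>j=1..J. prob_of J \<pi> j) = 1"
      unfolding split by (simp add: prob_of_def)
    show "\<forall>j\<in>{1..J}. 0 < prob_of J \<pi> j"
      using that by (auto simp: prob_of_def simplex_def)
  qed
  have vecs: "vec (J - 1) (\<lambda>i. g (i + 1)) \<in> simplex J"
      "\<forall>j\<in>{1..J}. prob_of J (vec (J - 1) (\<lambda>i. g (i + 1))) j = g j"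
    if g: "(\<Sum>j=1..J. g j) = 1" "\<forall>j\<in>{1..J}. 0 < g j" for g :: "nat \<Rightarrow> real"
  proof -
    have J: "g J > 0" using g(2) assms(1) by simp
    have s: "(\<Sum>i<J - 1. g (i + 1)) = 1 - g J" using g(1) split[of g] by simp
    have le: "g (i + 1) \<le> (\<Sum>i<J - 1. g (i + 1))" if "i < J - 1" for i
      by (rule member_le_sum) (use g that in \<open>auto intro: less_imp_le\<close>)
    show "vec (J - 1) (\<lambda>i. g (i + 1)) \<in> simplex J"
      using le g J s by (fastforce simp: simplex_def)
    show "\<forall>j\<in>{1..J}. prob_of J (vec (J - 1) (\<lambda>i. g (i + 1))) j = g j"
      using s by (auto simp: prob_of_def)
  qed
  have perm: "(\<Sum>j=1..J. prob_of J \<pi> (\<rho> j)) = 1" "\<forall>j\<in>{1..J}. 0 < prob_of J \<pi> (\<rho> j)"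
    if "\<pi> \<in> simplex J" "\<rho> permutes {1..J}" for \<pi> \<rho>
    using probs[OF that(1)] sum.permute[OF that(2), of "prob_of J \<pi>"] permutes_in_image[OF that(2)]
    by (auto simp: o_def)
  have mem: "permute_probs J \<rho> \<pi> \<in> simplex J"
    and pr: "\<forall>j\<in>{1..J}. prob_of J (permute_probs J \<rho> \<pi>) j = prob_of J \<pi> (\<rho> j)"
    if "\<pi> \<in> simplex J" "\<rho> permutes {1..J}" for \<pi> \<rho>
    using vecs[OF perm[OF that]] by (simp_all add: permute_probs_def)
  have inv: "permute_probs J \<rho> (permute_probs J \<rho>' \<pi>) = \<pi>"
    if "\<pi> \<in> simplex J" "\<rho> permutes {1..J}" "\<rho>' permutes {1..J}" "\<And>j. \<rho>' (\<rho> j) = j" for \<pi> \<rho> \<rho>'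
  proof (rule eq_vecI)
    fix i assume "i < dim_vec \<pi>"
    then have i: "i < J - 1" using that(1) by (auto simp: simplex_def)
    then have "\<rho> (i + 1) \<in> {1..J}" using permutes_in_image[OF that(2), of "i + 1"] by simp
    then show "permute_probs J \<rho> (permute_probs J \<rho>' \<pi>) $ i = \<pi> $ i"
      using pr[OF that(1,3)] i that(4)[of "i + 1"]
      by (simp add: permute_probs_def[of J \<rho>] prob_of_def[of J \<pi> "Suc i"])
  qed (use that(1) in \<open>auto simp: permute_probs_def simplex_def\<close>)
  have \<sigma>': "Hilbert_Choice.inv \<sigma> permutes {1..J}" using permutes_inv[OF \<sigma>] .
  show ?thesis
    by (rule bij_betw_byWitness[where f' = "permute_probs J (Hilbert_Choice.inv \<sigma>)"])
      (use inv[OF _ \<sigma>' \<sigma>] inv[OF _ \<sigma> \<sigma>'] mem \<sigma> \<sigma>' permutes_inverses[OF \<sigma>] in auto)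
qed

(* The descriptions in glm and permuted_glm are proper for the reference ratio and the logistic cdf. *)
lemma ex1_reference_logistic:
  assumes "\<eta> \<in> carrier_vec (J - 1)"
  shows "\<exists>!\<pi>. \<pi> \<in> simplex J \<and> reference J \<pi> = map_vec logistic \<eta>"
proof -
  have "0 < logistic w \<and> logistic w < 1" for w
    by (simp add: logistic_def add_pos_pos)
  then have "map_vec logistic \<eta> \<in> {u \<in> carrier_vec (J - 1). \<forall>i<J - 1. 0 < u $ i \<and> u $ i < 1}"
    using assms by auto
  then show ?thesis
    using reference_bij_betw[of J] unfolding bij_betw_def inj_on_def by (metis (no_types, lifting) imageE)
qed

lemma ex1_permuted_reference_logistic:
  assumes "\<eta> \<in> carrier_vec (J - 1)" and "2 \<le> J" and "\<sigma> permutes {1..J}"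
  shows "\<exists>!\<pi>. \<pi> \<in> simplex J \<and> reference J (permute_probs J \<sigma> \<pi>) = map_vec logistic \<eta>"
proof -
  obtain \<pi> where \<pi>: "\<pi> \<in> simplex J" "reference J \<pi> = map_vec logistic \<eta>"
    and unique: "\<And>\<pi>'. \<pi>' \<in> simplex J \<Longrightarrow> reference J \<pi>' = map_vec logistic \<eta> \<Longrightarrow> \<pi>' = \<pi>"
    using ex1_reference_logistic[OF assms(1)] by blast
  note bij = permute_probs_bij_betw[OF assms(2,3)]
  obtain \<pi>' where \<pi>': "\<pi>' \<in> simplex J" "permute_probs J \<sigma> \<pi>' = \<pi>"
    using \<pi>(1) bij by (metis bij_betw_imp_surj_on imageE)
  show ?thesis
  proof (rule ex1I[of _ \<pi>'])
    fix \<rho> assume \<rho>: "\<rho> \<in> simplex J \<and> reference J (permute_probs J \<sigma> \<rho>) = map_vec logistic \<eta>"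
    then have "permute_probs J \<sigma> \<rho> = \<pi>"
      using unique bij by (auto simp: bij_betw_def)
    then show "\<rho> = \<pi>'"
      using \<rho> \<pi>' bij by (auto simp: bij_betw_def dest: inj_onD)
  qed (use \<pi> \<pi>' in simp)
qed

end

theory Submission
  imports Defs
begin

text \<open>Under the reference ratio and the logistic cdf, the model equations say that the odds
  \<open>\<pi>\<^sub>j / \<pi>\<^sub>J\<close> equal \<open>exp \<eta>\<^sub>j\<close>. Permuting by \<open>\<tau>\<close>, which exchanges \<open>J\<close> and \<open>k\<close>, turns them into
  odds against category \<open>k\<close>; dividing these by the odds of \<open>J\<close> against \<open>k\<close>, which are
  \<open>exp \<eta>\<^sub>k\<close>, gives odds against \<open>J\<close> with predictors \<open>\<eta>\<^sub>j - \<eta>\<^sub>k\<close> for \<open>j \<noteq> k\<close> and \<open>- \<eta>\<^sub>k\<close> for \<open>k\<close>,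
  that is, the predictor \<open>B\<^sub>\<tau> \<eta>\<close>.\<close>

lemma prob_of_pos:
  assumes "\<pi> \<in> simplex J" and "j \<in> {1..J}"
  shows "0 < prob_of J \<pi> j"
  using assms by (auto simp: prob_of_def simplex_def)

lemma sum_prob_of: "1 \<le> J \<Longrightarrow> (\<Sum>j=1..J. prob_of J \<pi> j) = 1"
proof -
  assume "1 \<le> J"
  then obtain n where n: "J = Suc n" by (cases J) auto
  have "(\<Sum>j=1..n. prob_of J \<pi> j) = (\<Sum>i<n. \<pi> $ i)"
    by (rule sum.reindex_bij_witness[of _ Suc "\<lambda>j. j - 1"]) (auto simp: prob_of_def n)
  then show ?thesis by (simp add: n prob_of_def)
qed

text \<open>For \<open>j < J\<close> this unfolds the definition. The value at \<open>J\<close> is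
  only a complement, but both families sum to 1 over all categories and agree off \<open>J\<close>,
  so they agree at \<open>J\<close> too.\<close>

lemma prob_of_permute_probs:
  assumes "\<sigma> permutes {1..J}" and "j \<in> {1..J}"
  shows "prob_of J (permute_probs J \<sigma> \<pi>) j = prob_of J \<pi> (\<sigma> j)"
proof -
  have less: "prob_of J (permute_probs J \<sigma> \<pi>) j = prob_of J \<pi> (\<sigma> j)" if "j \<in> {1..J} - {J}" for j
    using that unfolding prob_of_def[of J "permute_probs J \<sigma> \<pi>"] by (auto simp: permute_probs_def)
  have "1 \<le> J" using assms(2) by simp
  have "(\<Sum>j=1..J. prob_of J (permute_probs J \<sigma> \<pi>) j) = (\<Sum>j=1..J. prob_of J \<pi> (\<sigma> j))"
    using sum_prob_of[OF \<open>1 \<le> J\<close>] sum.permute[OF assms(1), of "prob_of J \<pi>"] by (simp add: o_def)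
  moreover have "(\<Sum>j\<in>{1..J} - {J}. prob_of J (permute_probs J \<sigma> \<pi>) j)
      = (\<Sum>j\<in>{1..J} - {J}. prob_of J \<pi> (\<sigma> j))"
    by (rule sum.cong) (use less in auto)
  ultimately have "prob_of J (permute_probs J \<sigma> \<pi>) J = prob_of J \<pi> (\<sigma> J)"
    using \<open>1 \<le> J\<close> sum.remove[of "{1..J}" J "prob_of J (permute_probs J \<sigma> \<pi>)"]
      sum.remove[of "{1..J}" J "\<lambda>j. prob_of J \<pi> (\<sigma> j)"] by simp
  then show ?thesis using less assms(2) by (cases "j = J") auto
qed

text \<open>Cross-multiplying gives \<open>a * (1 + exp w) = exp w * (a + b)\<close>, and the term
  \<open>a * exp w\<close> cancels.\<close>

lemma ratio_eq_logistic_iff: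
  assumes "0 < a" and "0 < b"
  shows "a / (a + b) = logistic w \<longleftrightarrow> a = exp w * b"
proof -
  have "0 < a + b" and "0 < 1 + exp w" using assms by (simp_all add: add_pos_pos)
  then show ?thesis
    unfolding logistic_def by (simp add: frac_eq_eq ring_distribs)
qed

lemma reference_eq_logistic_iff:
  assumes \<pi>: "\<pi> \<in> simplex J" and \<eta>: "\<eta> \<in> carrier_vec (J - 1)"
  shows "reference J \<pi> = map_vec logistic \<eta> \<longleftrightarrow>
    (\<forall>i<J - 1. prob_of J \<pi> (i + 1) = exp (\<eta> $ i) * prob_of J \<pi> J)"
proof -
  have "reference J \<pi> = map_vec logistic \<eta> \<longleftrightarrow>
      (\<forall>i<J - 1. reference J \<pi> $ i = logistic (\<eta> $ i))"
    using \<eta> by (auto simp: vec_eq_iff reference_def)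
  also have "\<dots> \<longleftrightarrow> (\<forall>i<J - 1. prob_of J \<pi> (i + 1) = exp (\<eta> $ i) * prob_of J \<pi> J)"
    using prob_of_pos[OF \<pi>] by (simp add: reference_def ratio_eq_logistic_iff)
  finally show ?thesis .
qed

lemma B_matrix_mult_vec_index:
  assumes \<eta>: "\<eta> \<in> carrier_vec (J - 1)" and k: "\<tau> J \<in> {1..J - 1}" and i: "i < J - 1"
  shows "(B_matrix J \<tau> *\<^sub>v \<eta>) $ i = (if i + 1 = \<tau> J then 0 else \<eta> $ i) - \<eta> $ (\<tau> J - 1)"
proof -
  \<comment> \<open>Row \<open>i\<close> is the identity row minus the indicator of column
    \<open>\<tau> J - 1\<close>, except that the overwritten column also loses its diagonal 1, so
    the row with \<open>i + 1 = \<tau> J\<close> has no identity part.\<close>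
  have "(B_matrix J \<tau> *\<^sub>v \<eta>) $ i =
      (\<Sum>c<J - 1. (if c = i then if i + 1 = \<tau> J then 0 else \<eta> $ i else 0)
        - (if c = \<tau> J - 1 then \<eta> $ c else 0))"
    using \<eta> k i by (auto simp: B_matrix_def scalar_prod_def lessThan_atLeast0 intro!: sum.cong)
  also have "\<dots> = (if i + 1 = \<tau> J then 0 else \<eta> $ i) - \<eta> $ (\<tau> J - 1)"
    using k i by (auto simp: sum_subtractf)
  finally show ?thesis .
qed

text \<open>This equivalence at a fixed \<open>\<pi>\<close> is what makes the defining descriptions
  of the two models coincide.\<close>

lemma permuted_reference_eq_logistic_iff:
  assumes k: "k \<in> {1..J - 1}" and \<tau>: "\<tau> = Transposition.transpose J k"
    and \<pi>: "\<pi> \<in> simplex J" and \<eta>: "\<eta> \<in> carrier_vec (J - 1)"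
  shows "reference J (permute_probs J \<tau> \<pi>) = map_vec logistic \<eta> \<longleftrightarrow>
    reference J \<pi> = map_vec logistic (B_matrix J \<tau> *\<^sub>v \<eta>)"
proof -
  have perm: "\<tau> permutes {1..J}"
    unfolding \<tau> by (rule permutes_swap_id) (use k in auto)
  have "2 \<le> J" using k by auto
  then have "permute_probs J \<tau> \<pi> \<in> simplex J"
    using bij_betw_apply[OF permute_probs_bij_betw[OF _ perm] \<pi>] by simp
  note iffs = reference_eq_logistic_iff[OF this \<eta>]
    reference_eq_logistic_iff[OF \<pi>, of "B_matrix J \<tau> *\<^sub>v \<eta>"]
  define P where "P = prob_of J \<pi>"
  define e where "e j = exp (\<eta> $ (j - 1))" for j
  \<comment> \<open>Passing from vector indices to category numbers lets the equation of category
    \<open>k\<close> be split off.\<close>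
  have set: "(\<forall>i<J - 1. Q (i + 1)) \<longleftrightarrow> (\<forall>j\<in>{1..J - 1}. Q j)" for Q
    unfolding image_Suc_lessThan[symmetric] by auto
  have \<tau>J: "\<tau> J = k" by (simp add: \<tau>)
  have "reference J (permute_probs J \<tau> \<pi>) = map_vec logistic \<eta> \<longleftrightarrow>
      (\<forall>i<J - 1. P (\<tau> (i + 1)) = e (i + 1) * P k)"
    unfolding iffs(1) P_def e_def using prob_of_permute_probs[OF perm] k \<tau>J by simp
  also have "\<dots> \<longleftrightarrow> (\<forall>j\<in>{1..J - 1}. P (\<tau> j) = e j * P k)"
    by (rule set)
  \<comment> \<open>Only the equation at \<open>k\<close> changes under \<open>\<tau>\<close>: its
    left side becomes \<open>P J\<close>, while the other categories below \<open>J\<close> are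
    fixed.\<close>
  also have "\<dots> \<longleftrightarrow> P J = e k * P k \<and> (\<forall>j\<in>{1..J - 1} - {k}. P j = e j * P k)"
  proof -
    have "\<tau> k = J" by (simp add: \<tau>)
    moreover have "\<tau> j = j" if "j \<in> {1..J - 1} - {k}" for j
      using that by (auto simp: \<tau> Transposition.transpose_def)
    moreover have "{1..J - 1} = insert k ({1..J - 1} - {k})" using k by blast
    ultimately show ?thesis by (metis (no_types, lifting) insert_iff)
  qed
  \<comment> \<open>Since \<open>e k\<close> is an exponential, the first equation can be solved for
    \<open>P k\<close> and substituted into the others.\<close>
  also have "\<dots> \<longleftrightarrow> P k = P J / e k \<and> (\<forall>j\<in>{1..J - 1} - {k}. P j = e j / e k * P J)"
    by (auto simp: e_def)
  also have "\<dots> \<longleftrightarrow> (\<forall>j\<in>{1..J - 1}. P j = (if j = k then 1 else e j) / e k * P J)"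
    using k by auto
  also have "\<dots> \<longleftrightarrow> (\<forall>i<J - 1. P (i + 1) = (if i + 1 = k then 1 else e (i + 1)) / e k * P J)"
    by (rule set[symmetric])
  also have "\<dots> \<longleftrightarrow> reference J \<pi> = map_vec logistic (B_matrix J \<tau> *\<^sub>v \<eta>)"
  proof -
    have "B_matrix J \<tau> *\<^sub>v \<eta> \<in> carrier_vec (J - 1)"
      by (rule mult_mat_vec_carrier[OF _ \<eta>]) (simp add: B_matrix_def)
    \<comment> \<open>The numerator 1 at \<open>k\<close> is the exponential of the entry 0 left by
      the lost diagonal.\<close>
    moreover have "exp ((B_matrix J \<tau> *\<^sub>v \<eta>) $ i) = (if i + 1 = k then 1 else e (i + 1)) / e k"
      if "i < J - 1" for i
      using B_matrix_mult_vec_index[OF \<eta> _ that, of \<tau>] k by (simp add: \<tau>J e_def exp_diff)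
    ultimately show ?thesis using iffs(2) by (simp add: P_def)
  qed
  finally show ?thesis .
qed

theorem mainTheorem8:
  fixes J p q k :: nat and \<tau> :: "nat \<Rightarrow> nat" and X :: "real vec set" and Z :: "real vec \<Rightarrow> real mat"
  assumes "3 \<le> J" and "1 \<le> p"
    and "X \<noteq> {}" and "X \<subseteq> carrier_vec p"
    and "k \<in> {1..J - 1}" and "\<tau> = Transposition.transpose J k"
    and "Z \<in> design_matrices J p X q"
  shows "models_equal X
    (permuted_glm J \<tau> (reference J) logistic q Z)
    (glm J (reference J) logistic q (\<lambda>x. B_matrix J \<tau> * Z x))"
proof -
  have "reference J (permute_probs J \<tau> \<pi>) = map_vec logistic (Z x *\<^sub>v \<beta>) \<longleftrightarrow>
      reference J \<pi> = map_vec logistic (B_matrix J \<tau> * Z x *\<^sub>v \<beta>)"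
    if "x \<in> X" and \<beta>: "\<beta> \<in> carrier_vec q" and "\<pi> \<in> simplex J" for x \<beta> \<pi>
  proof -
    have Z: "Z x \<in> carrier_mat (J - 1) q"
      using assms(7) \<open>x \<in> X\<close> by (auto simp: design_matrices_def complete_design_def)
    have "B_matrix J \<tau> \<in> carrier_mat (J - 1) (J - 1)" by (simp add: B_matrix_def)
    then have "B_matrix J \<tau> * Z x *\<^sub>v \<beta> = B_matrix J \<tau> *\<^sub>v (Z x *\<^sub>v \<beta>)"
      using Z \<beta> by (rule assoc_mult_mat_vec)
    then show ?thesis
      using permuted_reference_eq_logistic_iff[OF assms(5,6) that(3)] mult_mat_vec_carrier[OF Z \<beta>]
      by simp
  qed
  \<comment> \<open>The equivalence holds only on the simplex, so \<open>conj_cong\<close> supplies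
    that membership when rewriting under the descriptions.\<close>
  then show ?thesis
    unfolding models_equal_def permuted_glm_def glm_def by (auto cong: conj_cong)
qed

end
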